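(* Let $G$ be a group with a representation on an ordered vector space $V$. Suppose that for every non-zero positive vector $v\in V$, the $G$-invariant ideal $V_{Gv}$ generated by the orbit $Gv$ admits a non-zero $G$-invariant positive linear functional. Then $V$ admits a $G$-invariant vector pricing.
   Context: An ordered vector space is a real vector space $V$ with a partial order compatible with addition and with multiplication by positive scalars; $V^+=\{v\in V:v\geq 0\}$. A representation of $G$ on $V$ is an action by positive linear maps (mapping $V^+$ into $V^+$). An ideal of $V$ is a vector subspace $W$ such that $w\leq v\leq w'$ with $w,w'\in W$, $v\in V$ implies $v\in W$. For $A\subseteq V$, $V_A$ denotes the ideal generated by $A$, i.e. the intersection of all ideals containing $A$. A linear functional $J$ on $V_{Gv}$ is positive if it is non-negative on $V_{Gv}\cap V^+$, and $G$-invariant if $J(gu)=J(u)$ for all $g\in G$, $u\in V_{Gv}$. A vector pricing on $V$ is a map $r\colon V^+\times V^+\to[0,+\infty]$ such that for all $u,v,w\in V^+$: (VP1) $r(u+v,w)=r(u,w)+r(v,w)$ when $w\neq 0$; (VP2) $r(u,w)=r(u,v)\,r(v,w)$ when defined (only the product of $0$ and $+\infty$ is undefined); (VP3) $r(u,u)=1$. It is $G$-invariant if $r(gu,v)=r(u,v)$ for all $g\in G$, $u,v\in V^+$. *)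

theory Defs
  imports
    "HOL-Library.Extended_Nonnegative_Real"
    "HOL-Algebra.Group_Action"
begin

text \<open>
  Ordered vector spaces are the types of class \<open>ordered_real_vector\<close>. Maps that
  mathematically live on the positive cone, or on a subspace, are total functions whose
  values outside that domain are never constrained nor used.
\<close>

definition positive_cone :: "'v::ordered_real_vector set"
  where "positive_cone = {v. 0 \<le> v}"

definition positive_representation ::
    "('g, 'm) monoid_scheme \<Rightarrow> ('g \<Rightarrow> 'v \<Rightarrow> 'v::ordered_real_vector) \<Rightarrow> bool"
  where "positive_representation G \<pi> \<longleftrightarrow>
    group_action G UNIV \<pi> \<and>
    (\<forall>g\<in>carrier G. linear (\<pi> g) \<and> \<pi> g ` positive_cone \<subseteq> positive_cone)"

definition order_ideal :: "'v::ordered_real_vector set \<Rightarrow> bool"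
  where "order_ideal W \<longleftrightarrow>
    subspace W \<and> (\<forall>w\<in>W. \<forall>w'\<in>W. \<forall>v. w \<le> v \<and> v \<le> w' \<longrightarrow> v \<in> W)"

definition generated_ideal :: "'v::ordered_real_vector set \<Rightarrow> 'v set"
  where "generated_ideal A = order_ideal hull A"

definition linear_functional_on :: "'v::real_vector set \<Rightarrow> ('v \<Rightarrow> real) \<Rightarrow> bool"
  where "linear_functional_on W J \<longleftrightarrow>
    (\<forall>u\<in>W. \<forall>v\<in>W. J (u + v) = J u + J v) \<and>
    (\<forall>c. \<forall>u\<in>W. J (c *\<^sub>R u) = c * J u)"

definition positive_functional_on :: "'v::ordered_real_vector set \<Rightarrow> ('v \<Rightarrow> real) \<Rightarrow> bool"
  where "positive_functional_on W J \<longleftrightarrow> (\<forall>u \<in> W \<inter> positive_cone. 0 \<le> J u)"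

definition invariant_functional_on ::
    "('g, 'm) monoid_scheme \<Rightarrow> ('g \<Rightarrow> 'v \<Rightarrow> 'v) \<Rightarrow> 'v set \<Rightarrow> ('v \<Rightarrow> real) \<Rightarrow> bool"
  where "invariant_functional_on G \<pi> W J \<longleftrightarrow>
    (\<forall>g\<in>carrier G. \<forall>u\<in>W. J (\<pi> g u) = J u)"

text \<open>
  In \<^typ>\<open>ennreal\<close> the product of \<open>0\<close> and \<open>\<infinity>\<close> is \<open>0\<close> by convention, so the
  cases in which the product is undefined are excluded explicitly.
\<close>

definition product_defined :: "ennreal \<Rightarrow> ennreal \<Rightarrow> bool"
  where "product_defined a b \<longleftrightarrow> \<not> (a = 0 \<and> b = \<infinity>) \<and> \<not> (a = \<infinity> \<and> b = 0)"

definition vector_pricing :: "('v::ordered_real_vector \<Rightarrow> 'v \<Rightarrow> ennreal) \<Rightarrow> bool"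
  where "vector_pricing r \<longleftrightarrow>
    (\<forall>u\<in>positive_cone. \<forall>v\<in>positive_cone. \<forall>w\<in>positive_cone.
      (w \<noteq> 0 \<longrightarrow> r (u + v) w = r u w + r v w) \<and>
      (product_defined (r u v) (r v w) \<longrightarrow> r u w = r u v * r v w) \<and>
      r u u = 1)"

definition invariant_pricing ::
    "('g, 'm) monoid_scheme \<Rightarrow> ('g \<Rightarrow> 'v \<Rightarrow> 'v::ordered_real_vector) \<Rightarrow> ('v \<Rightarrow> 'v \<Rightarrow> ennreal) \<Rightarrow> bool"
  where "invariant_pricing G \<pi> r \<longleftrightarrow>
    (\<forall>g\<in>carrier G. \<forall>u\<in>positive_cone. \<forall>v\<in>positive_cone. r (\<pi> g u) v = r u v)"

end

theory Submission
  imports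
    Defs
    "HOL-Analysis.Function_Topology"
    "HOL-Analysis.Extended_Real_Limits"
begin

text \<open>
  For a finite set \<open>F\<close> of positive vectors with nonzero sum \<open>v\<close>, an invariant positive
  functional \<open>J \<noteq> 0\<close> on the ideal of \<open>Gv\<close> satisfies \<open>J v > 0\<close>, hence does not vanish on all
  of \<open>F\<close>. Pricing by the quotient \<open>J u / J w\<close> and recursing on the strictly smaller set of
  vectors of \<open>F\<close> killed by \<open>J\<close> gives a function satisfying the axioms as long as all
  vectors involved lie in \<open>F\<close>. The axioms are closed conditions in the compact space
  \<open>[0,\<infinity>]\<^bsup>V \<times> V\<^esup>\<close>, so a global pricing exists by compactness.
\<close>

section \<open>Order ideals and the zeros of invariant functionals\<close>

lemma order_ideal_generated_ideal: "order_ideal (generated_ideal A)"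
  unfolding generated_ideal_def
proof (rule hull_in)
  fix T :: "'a set set"
  assume T: "Ball T order_ideal"
  show "order_ideal (\<Inter>T)"
    unfolding order_ideal_def
  proof (intro conjI ballI allI impI InterI)
    show "subspace (\<Inter>T)"
      using T by (intro subspace_Inter) (simp add: order_ideal_def)
    show "v \<in> S"
      if "w \<in> \<Inter>T" "w' \<in> \<Inter>T" "w \<le> v \<and> v \<le> w'" "S \<in> T" for w w' v S
    proof -
      have "order_ideal S" "w \<in> S" "w' \<in> S" using T that by blast+
      then show ?thesis using that(3) unfolding order_ideal_def by blast
    qed
  qed
qed

lemma generated_ideal_incl: "a \<in> A \<Longrightarrow> a \<in> generated_ideal A"
  unfolding generated_ideal_def by (rule hull_inc)

lemma generated_ideal_minimal: "A \<subseteq> I \<Longrightarrow> order_ideal I \<Longrightarrow> generated_ideal A \<subseteq> I"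
  unfolding generated_ideal_def by (rule hull_minimal)

text \<open>In the absence of lattice operations, the pair of bounds \<open>- s\<close> and
  \<open>s\<close> replaces an absolute value. Bounds killed by \<open>J\<close> can be added and
  rescaled by nonnegative factors. The resulting ideal serves to enclose the ideal generated by
  positive vectors that \<open>J\<close> kills.\<close>

lemma order_ideal_dominated:
  fixes W :: "'v::ordered_real_vector set"
  assumes "subspace W" and "linear_functional_on W J"
  shows "order_ideal {u. \<exists>s\<in>W. 0 \<le> s \<and> J s = 0 \<and> - s \<le> u \<and> u \<le> s}" (is "order_ideal ?I")
  unfolding order_ideal_def subspace_def
proof (intro conjI ballI allI impI)
  have J_add: "J (s + t) = J s + J t" and J_scale: "J (c *\<^sub>R s) = c * J s"
    if "s \<in> W" "t \<in> W" for s t c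
    using assms(2) that unfolding linear_functional_on_def by auto
  have W_add: "s + t \<in> W" and W_scale: "c *\<^sub>R s \<in> W"
    if "s \<in> W" "t \<in> W" for s t c
    using assms(1) that by (auto intro: subspace_add subspace_scale)
  have "0 \<in> W" using assms(1) by (rule subspace_0)
  moreover from this have "J 0 = 0" using J_scale[of 0 0 0] by simp
  ultimately show "0 \<in> ?I" by force
  fix x
  assume "x \<in> ?I"
  then obtain s where s: "s \<in> W" "0 \<le> s" "J s = 0" "- s \<le> x" "x \<le> s" by blast
  show "c *\<^sub>R x \<in> ?I" for c
  proof -
    have "- (\<bar>c\<bar> *\<^sub>R s) \<le> c *\<^sub>R x \<and> c *\<^sub>R x \<le> \<bar>c\<bar> *\<^sub>R s"
    proof (cases "0 \<le> c")
      case True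
      then show ?thesis
        using scaleR_left_mono[OF s(4), of c] scaleR_left_mono[OF s(5), of c] by simp
    next
      case False
      then show ?thesis
        using scaleR_left_mono[OF s(4), of "- c"] scaleR_left_mono[OF s(5), of "- c"]
        by (simp add: le_minus_iff[of "c *\<^sub>R x"])
    qed
    moreover have "0 \<le> \<bar>c\<bar> *\<^sub>R s" using s(2) by (simp add: scaleR_nonneg_nonneg)
    moreover have "\<bar>c\<bar> *\<^sub>R s \<in> W" "J (\<bar>c\<bar> *\<^sub>R s) = 0"
      using s W_scale J_scale by simp_all
    ultimately show ?thesis by blast
  qed
  fix y
  assume "y \<in> ?I"
  then obtain t where t: "t \<in> W" "0 \<le> t" "J t = 0" "- t \<le> y" "y \<le> t" by blast
  have st: "s + t \<in> W" "0 \<le> s + t" "J (s + t) = 0"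
    using s t W_add J_add by (auto intro: add_nonneg_nonneg)
  have "- (s + t) \<le> x + y"
    using add_mono[OF s(4) t(4)] by simp
  then show "x + y \<in> ?I"
    using st add_mono[OF s(5) t(5)] by blast
  fix z
  assume z: "x \<le> z \<and> z \<le> y"
  \<comment> \<open>The lower bound on \<open>z\<close> comes from \<open>x\<close> and the upper
    one from \<open>y\<close>; \<open>s + t\<close> weakens both to one symmetric bound.\<close>
  have "- (s + t) \<le> - s" using t(2) by simp
  also have "\<dots> \<le> z" using s(4) z by (meson order_trans)
  finally have "- (s + t) \<le> z" .
  moreover have "t \<le> s + t" using s(2) by simp
  then have "z \<le> s + t" using t(5) z by (meson order_trans)
  ultimately show "z \<in> ?I" using st by blast
qed

text \<open>If \<open>J v\<close> were zero, invariance would make \<open>J\<close> vanish on the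
  whole orbit. Every element of \<open>W\<close> would then be squeezed between null vectors
  \<open>- s\<close> and \<open>s\<close>, so positivity would force \<open>J\<close> to vanish on
  \<open>W\<close>.\<close>

lemma positive_invariant_functional_pos:
  fixes \<pi> :: "'g \<Rightarrow> 'v \<Rightarrow> 'v::ordered_real_vector"
  assumes "positive_representation G \<pi>" and "v \<in> positive_cone"
    and W: "W = generated_ideal (orbit G \<pi> v)"
    and lin: "linear_functional_on W J" and pos: "positive_functional_on W J"
    and inv: "invariant_functional_on G \<pi> W J"
    and "v \<in> W" and u: "u \<in> W" "J u \<noteq> 0"
  shows "0 < J v"
proof (rule ccontr)
  assume "\<not> 0 < J v"
  moreover have "0 \<le> J v"
    using pos assms(2,7) unfolding positive_functional_on_def by blast
  ultimately have "J v = 0" by simp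
  have sub: "subspace W"
    using order_ideal_generated_ideal W unfolding order_ideal_def by blast
  have "orbit G \<pi> v \<subseteq> {u. \<exists>s\<in>W. 0 \<le> s \<and> J s = 0 \<and> - s \<le> u \<and> u \<le> s}"
  proof
    fix x
    assume x: "x \<in> orbit G \<pi> v"
    then obtain g where g: "g \<in> carrier G" "x = \<pi> g v" unfolding orbit_def by blast
    have "0 \<le> x"
      using assms(1,2) g unfolding positive_representation_def positive_cone_def by blast
    \<comment> \<open>A nonnegative orbit point can serve as its own bound \<open>s\<close>.\<close>
    moreover have "- x \<le> x" using \<open>0 \<le> x\<close> by (meson neg_le_0_iff_le order_trans)
    moreover have "x \<in> W" using x W generated_ideal_incl by blast
    moreover have "J x = 0"
      using inv g assms(7) \<open>J v = 0\<close> unfolding invariant_functional_on_def by simp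
    ultimately show "x \<in> {u. \<exists>s\<in>W. 0 \<le> s \<and> J s = 0 \<and> - s \<le> u \<and> u \<le> s}" by blast
  qed
  then have "W \<subseteq> {u. \<exists>s\<in>W. 0 \<le> s \<and> J s = 0 \<and> - s \<le> u \<and> u \<le> s}"
    using generated_ideal_minimal order_ideal_dominated[OF sub lin] W by blast
  then obtain s where s: "s \<in> W" "J s = 0" "- s \<le> u" "u \<le> s" using u by blast
  have add: "J (a + b) = J a + J b" and nonneg: "0 \<le> a \<Longrightarrow> 0 \<le> J a"
    if "a \<in> W" "b \<in> W" for a b
    using lin pos that
    unfolding linear_functional_on_def positive_functional_on_def positive_cone_def by auto
  \<comment> \<open>Since \<open>J s = 0\<close>, positivity at \<open>s + u\<close> and at
    \<open>s - u\<close> bounds \<open>J u\<close> by zero from both sides.\<close>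
  have "0 \<le> J (s + u)"
    using nonneg s u sub by (metis add.commute diff_ge_0_iff_ge diff_minus_eq_add subspace_add)
  moreover have "0 \<le> J (s - u)"
    using nonneg s u sub by (metis diff_ge_0_iff_ge subspace_diff)
  moreover have "J s = J (s - u) + J u"
    using add[of "s - u" u] s u sub by (simp add: subspace_diff)
  ultimately show False using add[of s u] s u by simp
qed

section \<open>Pricings on subsets of the cone\<close>

definition pricing_within ::
    "('g, 'm) monoid_scheme \<Rightarrow> ('g \<Rightarrow> 'v \<Rightarrow> 'v::ordered_real_vector) \<Rightarrow> 'v set \<Rightarrow>
      ('v \<Rightarrow> 'v \<Rightarrow> ennreal) \<Rightarrow> bool"
  where "pricing_within G \<pi> F r \<longleftrightarrow>
    (\<forall>u\<in>F. \<forall>v\<in>F. \<forall>w\<in>F.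
      (u + v \<in> F \<and> w \<noteq> 0 \<longrightarrow> r (u + v) w = r u w + r v w) \<and>
      (product_defined (r u v) (r v w) \<longrightarrow> r u w = r u v * r v w) \<and>
      r u u = 1 \<and>
      (\<forall>g\<in>carrier G. \<pi> g u \<in> F \<longrightarrow> r (\<pi> g u) v = r u v))"

text \<open>The clauses about \<open>u + v\<close> and \<open>\<pi> g u\<close> are guarded by
  membership in \<open>F\<close>, so shrinking \<open>F\<close> only discards constraints. In
  particular \<open>F\<close> need not be closed under sums or under the action and may be
  finite.\<close>

lemma pricing_within_mono: "F \<subseteq> F' \<Longrightarrow> pricing_within G \<pi> F' r \<Longrightarrow> pricing_within G \<pi> F r"
  unfolding pricing_within_def by blast

text \<open>Vectors killed by \<open>J\<close> are infinitely cheap compared with the others, and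
  \<open>r\<close> prices them among themselves. Division in \<open>ennreal\<close> covers the mixed
  cases: a nonzero number over zero is infinity, and zero over a nonzero number is zero.\<close>

lemma pricing_within_extend:
  assumes "pricing_within G \<pi> {u \<in> F. J u = 0} r"
    and nonneg: "\<And>u. u \<in> F \<Longrightarrow> 0 \<le> J u"
    and add: "\<And>u v. u \<in> F \<Longrightarrow> v \<in> F \<Longrightarrow> J (u + v) = J u + J v"
    and inv: "\<And>g u. g \<in> carrier G \<Longrightarrow> u \<in> F \<Longrightarrow> J (\<pi> g u) = J u"
  shows "pricing_within G \<pi> F
    (\<lambda>u w. if J u = 0 \<and> J w = 0 then r u w else ennreal (J u) / ennreal (J w))"
    (is "pricing_within _ _ _ ?r")
proof -
  note * = assms(1)[unfolded pricing_within_def, rule_format]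
  \<comment> \<open>\<open>r\<close> is controlled only on the null part of \<open>F\<close>;
    additivity of \<open>J\<close> places \<open>u + v\<close> there, and invariance does the same
    for \<open>\<pi> g u\<close> below.\<close>
  have r_add: "r (u + v) w = r u w + r v w"
    if "u \<in> F" "v \<in> F" "w \<in> F" "u + v \<in> F" "w \<noteq> 0" "J u = 0" "J v = 0" "J w = 0" for u v w
    using *[of u v w] that add[of u v] by auto
  have r_mult: "r u w = r u v * r v w"
    if "u \<in> F" "v \<in> F" "w \<in> F" "J u = 0" "J v = 0" "J w = 0"
      "product_defined (r u v) (r v w)" for u v w
    using *[of u v w] that by auto
  have r_refl: "r u u = 1" if "u \<in> F" "J u = 0" for u
    using *[of u u u] that by auto
  have r_inv: "r (\<pi> g u) v = r u v"
    if "u \<in> F" "v \<in> F" "J u = 0" "J v = 0" "g \<in> carrier G" "\<pi> g u \<in> F" for g u v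
    using *[of u v v] that inv[of g u] by auto
  define R where "R = ?r"
  \<comment> \<open>These three rules exhaust all pairs in \<open>F\<close>; the last one includes
    the value 0 for null \<open>u\<close>.\<close>
  have R_zero: "R u w = r u w" if "J u = 0" "J w = 0" for u w
    using that by (simp add: R_def)
  have R_top: "R u w = \<infinity>" if "u \<in> F" "J u \<noteq> 0" "J w = 0" for u w
    using that nonneg[OF that(1)] by (simp add: R_def)
  have R_quot: "R u w = ennreal (J u / J w)" if "u \<in> F" "w \<in> F" "J w \<noteq> 0" for u w
    using that nonneg[OF that(1)] nonneg[OF that(2)] by (simp add: R_def divide_ennreal)
  show ?thesis
    unfolding pricing_within_def R_def[symmetric]
  proof (intro ballI conjI impI)
    fix u v w
    assume F: "u \<in> F" "v \<in> F" "w \<in> F"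
    note J = nonneg[OF F(1)] nonneg[OF F(2)] nonneg[OF F(3)]
    show "R (u + v) w = R u w + R v w" if uv: "u + v \<in> F \<and> w \<noteq> 0"
    proof (cases "J w = 0")
      case False
      then show ?thesis
        using F J uv by (simp add: R_quot add[OF F(1,2)] add_divide_distrib)
    next
      case w: True
      show ?thesis
      proof (cases "J u = 0 \<and> J v = 0")
        case True
        then show ?thesis
          using F w uv r_add[of u v w] by (simp add: R_zero add[OF F(1,2)])
      next
        case False
        \<comment> \<open>Nonnegative values cannot cancel. With \<open>w\<close> null, the sum and
          at least one summand have infinite price.\<close>
        then have "J (u + v) \<noteq> 0"
          using J add[OF F(1,2)] by (simp add: add_nonneg_eq_0_iff)
        then show ?thesis
          using False F w uv R_top by auto
      qed
    qed
    show "R u w = R u v * R v w" if d: "product_defined (R u v) (R v w)"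
    proof (cases "J v = 0")
      case v: True
      show ?thesis
      proof (cases "J w = 0")
        case w: True
        show ?thesis
        proof (cases "J u = 0")
          case True
          then show ?thesis
            using F v w d r_mult[of u v w] by (simp add: R_zero)
        next
          case False
          \<comment> \<open>Definedness excludes \<open>R v w = 0\<close>, so the product is
            infinite as well.\<close>
          then have "R u v = \<infinity>" "R u w = \<infinity>"
            using F v w by (simp_all add: R_top)
          then show ?thesis
            using d by (simp add: product_defined_def ennreal_top_mult)
        qed
      next
        case False
        then have "R v w = 0" using F v by (simp add: R_quot)
        \<comment> \<open>Definedness is what forces \<open>u\<close> to be null here; otherwise the
          right side would be the undefined infinity times 0.\<close>
        moreover from this have "R u v \<noteq> \<infinity>" using d by (auto simp: product_defined_def)
        then have "J u = 0" using F v R_top by blast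
        then have "R u w = 0" using False F by (simp add: R_quot)
        ultimately show ?thesis by simp
      qed
    next
      case v: False
      show ?thesis
      proof (cases "J w = 0")
        case w: True
        then have "R v w = \<infinity>" using F v by (simp add: R_top)
        moreover from this have "R u v \<noteq> 0" using d by (auto simp: product_defined_def)
        moreover from this have "J u \<noteq> 0" using F v by (auto simp: R_quot)
        then have "R u w = \<infinity>" using F w by (simp add: R_top)
        ultimately show ?thesis by (simp add: ennreal_mult_top)
      next
        case False
        then show ?thesis
          using F J v by (simp add: R_quot flip: ennreal_mult)
      qed
    qed
    show "R u u = 1"
      using F r_refl[of u] by (cases "J u = 0") (simp_all add: R_zero R_quot)
    show "R (\<pi> g u) v = R u v" if "g \<in> carrier G" "\<pi> g u \<in> F" for g
      using that F r_inv[of u v g] inv[of g u] by (simp add: R_def)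
  qed
qed

text \<open>The induction descends along strict subsets: each functional prices some vectors of
  \<open>F\<close> and leaves the remaining ones to a functional of the next, smaller scale.\<close>

lemma pricing_within_finite:
  fixes \<pi> :: "'g \<Rightarrow> 'v \<Rightarrow> 'v::ordered_real_vector"
  assumes "positive_representation G \<pi>"
    and "\<And>v :: 'v. v \<in> positive_cone \<Longrightarrow> v \<noteq> 0 \<Longrightarrow>
      \<exists>J. linear_functional_on (generated_ideal (orbit G \<pi> v)) J \<and>
          positive_functional_on (generated_ideal (orbit G \<pi> v)) J \<and>
          invariant_functional_on G \<pi> (generated_ideal (orbit G \<pi> v)) J \<and>
          (\<exists>u \<in> generated_ideal (orbit G \<pi> v). J u \<noteq> 0)"
    and "finite F" and "F \<subseteq> positive_cone"
  shows "\<exists>r. pricing_within G \<pi> F r"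
  using assms(3,4)
proof (induction F rule: finite_psubset_induct)
  case (psubset F)
  have F_pos: "0 \<le> u" if "u \<in> F" for u
    using psubset.prems that unfolding positive_cone_def by blast
  define v where "v = \<Sum>F"
  have le_v: "u \<le> v" if "u \<in> F" for u
    unfolding v_def using psubset.hyps F_pos that sum_nonneg[of "F - {u}" "\<lambda>x. x"]
    by (simp add: sum.remove)
  have v_pos: "v \<in> positive_cone"
    unfolding v_def positive_cone_def using F_pos by (simp add: sum_nonneg)
  show ?case
  proof (cases "v = 0")
    case True
    \<comment> \<open>Every member lies between 0 and \<open>v\<close>. On \<open>{0}\<close> the
      constant price 1 is admissible because additivity is required only for
      \<open>w \<noteq> 0\<close>.\<close>
    then have "F \<subseteq> {0}" using le_v F_pos by (auto intro: antisym)
    then have "pricing_within G \<pi> F (\<lambda>_ _. 1)"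
      unfolding pricing_within_def by auto
    then show ?thesis by blast
  next
    case False
    define W where "W = generated_ideal (orbit G \<pi> v)"
    obtain J u where J: "linear_functional_on W J" "positive_functional_on W J"
        "invariant_functional_on G \<pi> W J" "u \<in> W" "J u \<noteq> 0"
      using assms(2)[OF v_pos False] unfolding W_def by blast
    interpret group_action G UNIV \<pi>
      using assms(1) unfolding positive_representation_def by blast
    have "v \<in> orbit G \<pi> v" using orbit_refl by blast
    then have "v \<in> W" unfolding W_def by (rule generated_ideal_incl)
    then have Jv: "0 < J v"
      using positive_invariant_functional_pos[OF assms(1) v_pos W_def] J by blast
    have "order_ideal W" unfolding W_def by (rule order_ideal_generated_ideal)
    then have sub: "subspace W"
      and conv: "\<And>x y z. x \<in> W \<Longrightarrow> z \<in> W \<Longrightarrow> x \<le> y \<Longrightarrow> y \<le> z \<Longrightarrow> y \<in> W"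
      unfolding order_ideal_def by blast+
    \<comment> \<open>The choice of \<open>v\<close> as the sum pays off: one ideal, hence one
      functional, handles all of \<open>F\<close> by order convexity.\<close>
    have F_W: "F \<subseteq> W"
      using conv[OF subspace_0[OF sub] \<open>v \<in> W\<close>] F_pos le_v by blast
    have "{u \<in> F. J u = 0} \<subset> F"
    proof (rule ccontr)
      assume "\<not> {u \<in> F. J u = 0} \<subset> F"
      then have zero: "J u = 0" if "u \<in> F" for u using that by blast
      have "J (\<Sum>S) = 0" if "finite S" "S \<subseteq> F" for S
        using that
      proof (induction S)
        case empty
        have "J (0 *\<^sub>R v) = 0 * J v"
          using J(1) \<open>v \<in> W\<close> unfolding linear_functional_on_def by blast
        then show ?case by simp
      next
        case (insert x S)
        have "\<Sum>S \<in> W" using insert.prems F_W sub by (intro subspace_sum) auto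
        then have "J (x + \<Sum>S) = J x + J (\<Sum>S)"
          using J(1) insert.prems F_W unfolding linear_functional_on_def by blast
        then show ?case using insert zero by simp
      qed
      then show False using Jv psubset.hyps unfolding v_def by auto
    qed
    moreover have "{u \<in> F. J u = 0} \<subseteq> positive_cone"
      using psubset.prems by blast
    ultimately obtain r where "pricing_within G \<pi> {u \<in> F. J u = 0} r"
      using psubset.IH by blast
    then have "pricing_within G \<pi> F
        (\<lambda>u w. if J u = 0 \<and> J w = 0 then r u w else ennreal (J u) / ennreal (J w))"
    proof (rule pricing_within_extend)
      show "0 \<le> J u" if "u \<in> F" for u
        using that J(2) F_W psubset.prems unfolding positive_functional_on_def by blast
      show "J (u + v) = J u + J v" if "u \<in> F" "v \<in> F" for u v
        using that J(1) F_W unfolding linear_functional_on_def by blast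
      show "J (\<pi> g u) = J u" if "g \<in> carrier G" "u \<in> F" for g u
        using that J(3) F_W unfolding invariant_functional_on_def by blast
    qed
    then show ?thesis by blast
  qed
qed

section \<open>Compactness of the space of price functions\<close>

lemma compact_UNIV_fun:
  assumes "compact (UNIV :: 'b::topological_space set)"
  shows "compact (UNIV :: ('a \<Rightarrow> 'b) set)"
proof -
  have "compact_space (euclidean :: 'b topology)"
    using assms by (simp add: compact_space_def)
  then have "compact_space (euclidean :: ('a \<Rightarrow> 'b) topology)"
    by (simp add: compact_space_product_topology flip: euclidean_product_topology)
  then show ?thesis by (simp add: compact_space_def)
qed

lemma open_product_defined: "open {(a, b). product_defined a b}"
proof -
  have "{(a, b). product_defined a b} = - {(0, \<infinity>), (\<infinity>, 0)}"
    by (auto simp: product_defined_def)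
  then show ?thesis by (simp add: finite_imp_closed open_Compl)
qed

text \<open>Multiplication on \<open>ennreal\<close> is discontinuous only at the two pairs excluded
  by \<open>product_defined\<close>. The set \<open>D\<close> where the product is defined is open,
  and the violations of the equation form an open subset of it.\<close>

lemma closed_Collect_mult_when_defined:
  fixes f g h :: "'a::topological_space \<Rightarrow> ennreal"
  assumes f: "continuous_on UNIV f" and g: "continuous_on UNIV g" and h: "continuous_on UNIV h"
  shows "closed {x. product_defined (f x) (g x) \<longrightarrow> h x = f x * g x}"
proof -
  define D where "D = {x. product_defined (f x) (g x)}"
  have "open ((\<lambda>x. (f x, g x)) -` {(a, b). product_defined a b})"
    by (intro open_vimage open_product_defined continuous_on_Pair f g)
  then have "open D" by (simp add: D_def vimage_def)
  have "continuous_on D (\<lambda>x. f x * g x)"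
    unfolding continuous_on_def
  proof
    fix x
    assume "x \<in> D"
    have "(f \<longlongrightarrow> f x) (at x within D)" "(g \<longlongrightarrow> g x) (at x within D)"
      using f g \<open>x \<in> D\<close> by (meson continuous_on_def continuous_on_subset subset_UNIV)+
    then show "((\<lambda>x. f x * g x) \<longlongrightarrow> f x * g x) (at x within D)"
      using \<open>x \<in> D\<close> by (intro tendsto_mult_ennreal) (auto simp: D_def product_defined_def)
  qed
  then have "continuous_on D (\<lambda>x. (h x, f x * g x))"
    by (intro continuous_on_Pair continuous_on_subset[OF h]) auto
  moreover have "open {p :: ennreal \<times> ennreal. fst p \<noteq> snd p}"
    by (intro open_Collect_neq continuous_on_fst continuous_on_snd continuous_on_id)
  ultimately have "open (D \<inter> (\<lambda>x. (h x, f x * g x)) -` {p. fst p \<noteq> snd p})"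
    by (rule continuous_open_preimage[OF _ \<open>open D\<close>])
  moreover have "{x. product_defined (f x) (g x) \<longrightarrow> h x = f x * g x} =
      - (D \<inter> (\<lambda>x. (h x, f x * g x)) -` {p. fst p \<noteq> snd p})"
    by (auto simp: D_def)
  ultimately show ?thesis by (simp only: closed_Compl)
qed

lemma closed_pricing_within: "closed {r. pricing_within G \<pi> F r}"
proof -
  have coord: "continuous_on UNIV (\<lambda>r :: 'a \<Rightarrow> 'a \<Rightarrow> ennreal. r u v)" for u v
    by (rule continuous_on_product_then_coordinatewise[OF continuous_on_product_coordinates])
  have "closed {r :: 'a \<Rightarrow> 'a \<Rightarrow> ennreal. r (u + v) w = r u w + r v w}" for u v w
    by (intro closed_Collect_eq continuous_on_add coord)
  moreover have "closed {r :: 'a \<Rightarrow> 'a \<Rightarrow> ennreal.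
      product_defined (r u v) (r v w) \<longrightarrow> r u w = r u v * r v w}" for u v w
    by (rule closed_Collect_mult_when_defined[OF coord coord coord])
  moreover have "closed {r :: 'a \<Rightarrow> 'a \<Rightarrow> ennreal. r u u = 1}" for u
    by (intro closed_Collect_eq continuous_on_const coord)
  moreover have "closed {r :: 'a \<Rightarrow> 'a \<Rightarrow> ennreal. r (\<pi> g u) v = r u v}" for g u v
    by (intro closed_Collect_eq coord)
  \<comment> \<open>The remaining guards, such as \<open>u + v \<in> F\<close> and
    \<open>w \<noteq> 0\<close>, do not depend on \<open>r\<close>, which is why
    \<open>open_Collect_const\<close> deals with them.\<close>
  ultimately show ?thesis
    unfolding pricing_within_def Ball_def
    by (intro closed_Collect_all closed_Collect_imp[OF open_Collect_const] closed_Collect_conj)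
qed

theorem theorem7:
  fixes G :: "('g, 'm) monoid_scheme"
    and \<pi> :: "'g \<Rightarrow> 'v \<Rightarrow> 'v::ordered_real_vector"
  assumes "group G"
    and "positive_representation G \<pi>"
    and "\<And>v :: 'v. v \<in> positive_cone \<Longrightarrow> v \<noteq> 0 \<Longrightarrow>
      \<exists>J. linear_functional_on (generated_ideal (orbit G \<pi> v)) J \<and>
          positive_functional_on (generated_ideal (orbit G \<pi> v)) J \<and>
          invariant_functional_on G \<pi> (generated_ideal (orbit G \<pi> v)) J \<and>
          (\<exists>u \<in> generated_ideal (orbit G \<pi> v). J u \<noteq> 0)"
  shows "\<exists>r :: 'v \<Rightarrow> 'v \<Rightarrow> ennreal. vector_pricing r \<and> invariant_pricing G \<pi> r"
proof -
  define fam where "fam = {F :: 'v set. finite F \<and> F \<subseteq> positive_cone}"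
  have "UNIV \<inter> (\<Inter>F\<in>fam. {r. pricing_within G \<pi> F r}) \<noteq> {}"
  proof (rule compact_imp_fip_image)
    show "compact (UNIV :: ('v \<Rightarrow> 'v \<Rightarrow> ennreal) set)"
      \<comment> \<open>Tychonoff is applied once for each of the two curried arguments, starting
        from compactness of \<open>ennreal\<close>.\<close>
      by (intro compact_UNIV_fun compact_UNIV)
    show "closed {r. pricing_within G \<pi> F r}" for F :: "'v set"
      by (rule closed_pricing_within)
    fix I
    assume I: "finite I" "I \<subseteq> fam"
    then have "finite (\<Union>I)" "\<Union>I \<subseteq> positive_cone"
      unfolding fam_def by auto
    \<comment> \<open>The union of finitely many members of \<open>fam\<close> is again finite, so a
      single pricing on it lies in all the chosen closed sets.\<close>
    then obtain r where "pricing_within G \<pi> (\<Union>I) r"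
      using pricing_within_finite[OF assms(2,3)] by blast
    then have "pricing_within G \<pi> F r" if "F \<in> I" for F
      using that by (meson Union_upper pricing_within_mono)
    then show "UNIV \<inter> (\<Inter>F\<in>I. {r. pricing_within G \<pi> F r}) \<noteq> {}" by blast
  qed
  then obtain r :: "'v \<Rightarrow> 'v \<Rightarrow> ennreal" where r: "\<And>F. F \<in> fam \<Longrightarrow> pricing_within G \<pi> F r"
    by blast
  have pos_add: "u + v \<in> positive_cone" if "u \<in> positive_cone" "v \<in> positive_cone" for u v :: 'v
    using that unfolding positive_cone_def by simp
  have pos_act: "\<pi> g u \<in> positive_cone" if "g \<in> carrier G" "u \<in> positive_cone" for g u
    using that assms(2) unfolding positive_representation_def by blast
  have "vector_pricing r"
    unfolding vector_pricing_def
  proof (intro ballI)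
    fix u v w :: 'v
    assume "u \<in> positive_cone" "v \<in> positive_cone" "w \<in> positive_cone"
    \<comment> \<open>Each instance of an axiom involves finitely many vectors; including
      \<open>u + v\<close> discharges the guard on additivity.\<close>
    then have "pricing_within G \<pi> {u, v, w, u + v} r"
      using pos_add by (intro r) (simp add: fam_def)
    then show "(w \<noteq> 0 \<longrightarrow> r (u + v) w = r u w + r v w) \<and>
        (product_defined (r u v) (r v w) \<longrightarrow> r u w = r u v * r v w) \<and> r u u = 1"
      unfolding pricing_within_def by blast
  qed
  moreover have "invariant_pricing G \<pi> r"
    unfolding invariant_pricing_def
  proof (intro ballI)
    fix g and u v :: 'v
    assume g: "g \<in> carrier G" and "u \<in> positive_cone" "v \<in> positive_cone"
    then have "pricing_within G \<pi> {u, v, \<pi> g u} r"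
      using pos_act by (intro r) (simp add: fam_def)
    then show "r (\<pi> g u) v = r u v"
      using g unfolding pricing_within_def by blast
  qed
  ultimately show ?thesis by blast
qed

end
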